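(* Let $I\subset S=K[x_1,\ldots,x_n]$ be a monomial ideal of Borel type and let $q$ be a positive integer. Then $\operatorname{Ass}(S/I^{((q))})\subset \operatorname{Ass}(S/I)$, where $I^{((q))}$ is the $q$-th quasi-symbolic power of $I$. In particular, $I^{((q))}$ is an ideal of Borel type.
   Context: $K$ is an infinite field and $S=K[x_1,\ldots,x_n]$, $n\geq 2$, is the polynomial ring. $\operatorname{Ass}(S/I)$ is the set of associated primes of the $S$-module $S/I$, and $\subset$ means (not necessarily strict) inclusion. Borel type: a monomial ideal $I\subset S$ is of Borel type if $(I:x_j^\infty)=(I:(x_1,\ldots,x_j)^\infty)$ for all $j=1,\ldots,n$, where $(I:J^\infty)=\bigcup_{k\ge 0}(I:J^k)$. Canonical presentation: an irreducible monomial ideal is a monomial ideal generated by positive powers of some of the variables (the zero ideal being the case of no variables). Every monomial ideal $I$ has a unique irredundant decomposition $I=\bigcap_{i=1}^s C_i$ into irreducible monomial ideals (the empty intersection being $S$). Let $P_1,\ldots,P_r$ be the distinct primes among the radicals $\sqrt{C_1},\ldots,\sqrt{C_s}$, and let $Q_i$ be the intersection of all $C_j$ with $\sqrt{C_j}=P_i$. Then $Q_i$ is $P_i$-primary and $I=\bigcap_{i=1}^r Q_i$ is called the canonical presentation of $I$ as an intersection of primary ideals. Quasi-symbolic power: for a positive integer $q$, $I^{((q))}:=\bigcap_{i=1}^r Q_i^q$, where $I=\bigcap_{i=1}^r Q_i$ is the canonical presentation and $Q_i^q$ is the ordinary $q$-th power. *)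

theory Defs
  imports
    "HOL-Library.Poly_Mapping"
    "HOL-Library.Cardinality"
    "HOL-Algebra.Ideal_Product"
    "HOL-Algebra.QuotRing"
    "HOL-Algebra.Algebraic_Closure_Type"
begin

section \<open>Notions for ideals of a commutative ring\<close>

abbreviation ideal_power :: "('a, 'b) ring_scheme \<Rightarrow> 'a set \<Rightarrow> nat \<Rightarrow> 'a set" where
  "ideal_power R I k \<equiv> I [^]\<^bsub>ideals_set R\<^esub> k"

definition colon_ideal :: "('a, 'b) ring_scheme \<Rightarrow> 'a set \<Rightarrow> 'a set \<Rightarrow> 'a set" where
  "colon_ideal R I J = {f \<in> carrier R. \<forall>g \<in> J. f \<otimes>\<^bsub>R\<^esub> g \<in> I}"

definition saturation :: "('a, 'b) ring_scheme \<Rightarrow> 'a set \<Rightarrow> 'a set \<Rightarrow> 'a set" where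
  "saturation R I J = (\<Union>k. colon_ideal R I (ideal_power R J k))"

definition radical_ideal :: "('a, 'b) ring_scheme \<Rightarrow> 'a set \<Rightarrow> 'a set" where
  "radical_ideal R I = {f \<in> carrier R. \<exists>k::nat. f [^]\<^bsub>R\<^esub> k \<in> I}"

text \<open>
  The associated primes of the \<open>R\<close>-module \<open>R/I\<close> are the prime ideals that are annihilators of
  elements \<open>c\<close> of \<open>R/I\<close>. The action of \<open>f \<in> R\<close> on \<open>c\<close> is multiplication by the class of \<open>f\<close> in the
  quotient ring.
\<close>

definition ass_quotient :: "('a, 'b) ring_scheme \<Rightarrow> 'a set \<Rightarrow> 'a set set" where
  "ass_quotient R I = {P. primeideal P R \<and>
     (\<exists>c \<in> carrier (R Quot I).
        P = {f \<in> carrier R. (I +>\<^bsub>R\<^esub> f) \<otimes>\<^bsub>R Quot I\<^esub> c = \<zero>\<^bsub>R Quot I\<^esub>})}"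


section \<open>The polynomial ring\<close>

text \<open>
  The variables are indexed by a finite linearly ordered type \<open>'n\<close>, whose elements in increasing
  order play the role of \<open>1, \<dots>, n\<close> with \<open>n = CARD('n)\<close>. A polynomial is a finitely supported map
  from exponent vectors to coefficients.
\<close>

type_synonym ('n, 'k) mpolynomial = "('n \<Rightarrow>\<^sub>0 nat) \<Rightarrow>\<^sub>0 'k"

abbreviation mpoly_ring :: "('n, 'k::field) mpolynomial ring" where
  "mpoly_ring \<equiv> ring_of_type_algebra"

definition monomial :: "('n \<Rightarrow>\<^sub>0 nat) \<Rightarrow> ('n, 'k::field) mpolynomial" where
  "monomial a = Poly_Mapping.single a 1"

definition var_power :: "'n \<Rightarrow> nat \<Rightarrow> ('n, 'k::field) mpolynomial" where
  "var_power i e = monomial (Poly_Mapping.single i e)"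

abbreviation variable :: "'n \<Rightarrow> ('n, 'k::field) mpolynomial" where
  "variable i \<equiv> var_power i 1"


section \<open>Monomial ideals\<close>

definition monomial_ideal :: "('n, 'k::field) mpolynomial set \<Rightarrow> bool" where
  "monomial_ideal I \<longleftrightarrow> (\<exists>A. I = Idl\<^bsub>mpoly_ring\<^esub> (monomial ` A))"

definition borel_type :: "('n::{finite,linorder}, 'k::field) mpolynomial set \<Rightarrow> bool" where
  "borel_type I \<longleftrightarrow> monomial_ideal I \<and>
     (\<forall>j. saturation mpoly_ring I (Idl\<^bsub>mpoly_ring\<^esub> {variable j}) =
          saturation mpoly_ring I (Idl\<^bsub>mpoly_ring\<^esub> (variable ` {..j})))"

definition irreducible_monomial_ideal :: "('n::finite, 'k::field) mpolynomial set \<Rightarrow> bool" where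
  "irreducible_monomial_ideal C \<longleftrightarrow>
     (\<exists>V e. (\<forall>i \<in> V. 0 < e i) \<and> C = Idl\<^bsub>mpoly_ring\<^esub> ((\<lambda>i. var_power i (e i)) ` V))"

text \<open>
  An irredundant decomposition has pairwise distinct components, so it can be given as a finite
  set. The empty intersection is \<open>UNIV\<close>, the whole polynomial ring.
\<close>

definition irredundant_decomposition ::
    "('n::finite, 'k::field) mpolynomial set \<Rightarrow> ('n, 'k) mpolynomial set set \<Rightarrow> bool" where
  "irredundant_decomposition I D \<longleftrightarrow>
     finite D \<and> (\<forall>C \<in> D. irreducible_monomial_ideal C) \<and> \<Inter>D = I \<and>
     (\<forall>C \<in> D. \<Inter>(D - {C}) \<noteq> I)"

definition irreducible_components ::
    "('n::finite, 'k::field) mpolynomial set \<Rightarrow> ('n, 'k) mpolynomial set set" where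
  "irreducible_components I = (THE D. irredundant_decomposition I D)"

definition primary_component ::
    "('n::finite, 'k::field) mpolynomial set \<Rightarrow> ('n, 'k) mpolynomial set \<Rightarrow>
     ('n, 'k) mpolynomial set" where
  "primary_component I P = \<Inter>{C \<in> irreducible_components I. radical_ideal mpoly_ring C = P}"

definition canonical_presentation ::
    "('n::finite, 'k::field) mpolynomial set \<Rightarrow> ('n, 'k) mpolynomial set set" where
  "canonical_presentation I =
     primary_component I ` radical_ideal mpoly_ring ` irreducible_components I"

definition quasi_symbolic_power ::
    "('n::finite, 'k::field) mpolynomial set \<Rightarrow> nat \<Rightarrow> ('n, 'k) mpolynomial set" where
  "quasi_symbolic_power I q = (\<Inter>Q \<in> canonical_presentation I. ideal_power mpoly_ring Q q)"

end

theory Submission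
  imports Defs "HOL-Library.Extended_Nat"
begin

text \<open>
  A primary component \<open>Q\<close> with radical \<open>P = (x\<^sub>i | i \<in> V)\<close> is generated by monomials in the variables
  from \<open>V\<close> and contains a power of each of them. Both properties pass to \<open>Q ^ q\<close> and imply that it
  is \<open>P\<close>-primary, so every associated prime of the quasi-symbolic power is one of the radicals \<open>P\<close>.
  Each \<open>P\<close> is associated to \<open>I\<close>, as the annihilator of a monomial that exists by irredundancy. If \<open>I\<close>
  is of Borel type, this monomial shows that \<open>V\<close> is an initial segment of the variables, and an
  intersection of primary monomial ideals with such radicals is again of Borel type.
\<close>

section \<open>Exponent vectors\<close>

text \<open>The monomial ideals are encoded as \<open>supported U\<close> for a set \<open>U\<close>
  of exponents, so that product, colon, intersection and saturation become operations on sets of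
  exponents. The obstacle is that associated primes are annihilators of arbitrary polynomials, whose
  terms may cancel; hence primariness has to be proved for polynomials and not only for monomials. A
  second obstacle is that the irreducible components are given by \<open>THE\<close>: nothing can be
  said about them before existence and uniqueness of the irredundant decomposition are established.
  The notion \<open>cylinder\<close> is chosen so that it implies primariness and yet survives
  finite intersections and sums of exponent sets, the two operations that lead from the irreducible
  components to \<open>Q\<close> and then to \<open>Q ^ q\<close>.\<close>

definition upset :: "('n \<Rightarrow>\<^sub>0 nat) set \<Rightarrow> bool" where
  "upset U \<longleftrightarrow> (\<forall>a b. a \<in> U \<longrightarrow> a + b \<in> U)"

definition sumset :: "('n \<Rightarrow>\<^sub>0 nat) set \<Rightarrow> ('n \<Rightarrow>\<^sub>0 nat) set \<Rightarrow> ('n \<Rightarrow>\<^sub>0 nat) set" where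
  "sumset U W = {a + b |a b. a \<in> U \<and> b \<in> W}"

text \<open>The zeroth power of an ideal is the whole ring, hence \<open>UNIV\<close>; for an upset
  \<open>U\<close> the first power is again \<open>U\<close>.\<close>

primrec sumset_power :: "('n \<Rightarrow>\<^sub>0 nat) set \<Rightarrow> nat \<Rightarrow> ('n \<Rightarrow>\<^sub>0 nat) set" where
  "sumset_power U 0 = UNIV"
| "sumset_power U (Suc k) = sumset (sumset_power U k) U"

abbreviation shift :: "'n \<Rightarrow> nat \<Rightarrow> 'n \<Rightarrow>\<^sub>0 nat" where
  "shift \<equiv> Poly_Mapping.single"

abbreviation expo :: "('n \<Rightarrow>\<^sub>0 nat) \<Rightarrow> 'n \<Rightarrow> nat" where
  "expo \<equiv> Poly_Mapping.lookup"

text \<open>The exponents of the monomials in the prime ideal generated by the variables from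
  \<open>V\<close>.\<close>

definition prime_exps :: "'n set \<Rightarrow> ('n \<Rightarrow>\<^sub>0 nat) set" where
  "prime_exps V = {a. \<exists>i\<in>V. 0 < expo a i}"

lemma le_imp_eq_add:
  assumes "\<And>i. expo a i \<le> expo b i"
  shows "b = a + (b - a)"
  by (rule poly_mapping_eqI) (simp add: lookup_add lookup_minus assms)

lemma upsetD: "upset U \<Longrightarrow> a \<in> U \<Longrightarrow> a + b \<in> U"
  by (simp add: upset_def)

lemma upset_le:
  assumes "upset U" "a \<in> U" "\<And>i. expo a i \<le> expo b i"
  shows "b \<in> U"
  using upsetD[OF assms(1,2)] le_imp_eq_add[OF assms(3)] by metis

lemma upset_sumset: "upset W \<Longrightarrow> upset (sumset U W)"
  unfolding upset_def sumset_def by (force simp: add.assoc)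

lemma upset_prime_exps: "upset (prime_exps V)"
  by (auto simp: upset_def prime_exps_def lookup_add)

lemma prime_exps_inj: "prime_exps V = prime_exps V' \<longleftrightarrow> V = V'"
proof
  assume *: "prime_exps V = prime_exps V'"
  have "i \<in> V \<longleftrightarrow> shift i 1 \<in> prime_exps V" for i and V :: "'a set"
    by (auto simp: prime_exps_def lookup_single when_def)
  with * show "V = V'" by blast
qed simp

section \<open>Polynomials supported on a set of exponents\<close>

text \<open>For an upset \<open>U\<close> this is the monomial ideal spanned by the monomials with
  exponent in \<open>U\<close>. Membership is tested term by term, and \<open>U\<close> can be
  recovered from the ideal.\<close>

definition supported :: "('n \<Rightarrow>\<^sub>0 nat) set \<Rightarrow> ('n, 'k::field) mpolynomial set" where
  "supported U = {f. Poly_Mapping.keys f \<subseteq> U}"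

lemma supported_inject: "supported U = (supported W :: ('n, 'k::field) mpolynomial set) \<longleftrightarrow> U = W"
proof
  assume *: "supported U = (supported W :: ('n, 'k) mpolynomial set)"
  have "a \<in> U \<longleftrightarrow> (monomial a :: ('n, 'k) mpolynomial) \<in> supported U" for a and U
    by (simp add: supported_def monomial_def)
  with * show "U = W" by blast
qed simp

lemma monomial_in_supported [simp]: "monomial a \<in> supported U \<longleftrightarrow> a \<in> U"
  by (simp add: supported_def monomial_def)

lemma supported_Inter: "supported (\<Inter>(W ` A)) = (\<Inter>a\<in>A. supported (W a))"
  by (auto simp: supported_def)

lemma sum_single_keys:
  fixes f :: "'a \<Rightarrow>\<^sub>0 'b::comm_monoid_add"
  shows "f = (\<Sum>a\<in>Poly_Mapping.keys f. Poly_Mapping.single a (Poly_Mapping.lookup f a))"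
  by (rule poly_mapping_eqI) (simp add: lookup_sum lookup_single when_def in_keys_iff)

text \<open>Reduces inclusions between ideals to single terms: a polynomial is the finite sum of its
  terms.\<close>

lemma additive_closure_memI:
  fixes f :: "'a \<Rightarrow>\<^sub>0 'b::comm_monoid_add"
  assumes "0 \<in> S" "\<And>x y. x \<in> S \<Longrightarrow> y \<in> S \<Longrightarrow> x + y \<in> S"
    and "\<And>a c. a \<in> Poly_Mapping.keys f \<Longrightarrow> Poly_Mapping.single a c \<in> S"
  shows "f \<in> S"
proof -
  have "(\<Sum>a\<in>A. Poly_Mapping.single a (Poly_Mapping.lookup f a)) \<in> S"
    if "A \<subseteq> Poly_Mapping.keys f" for A
    using finite_subset[OF that finite_keys] that
    by (induction A rule: finite_induct) (auto intro: assms)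
  from this[OF order_refl] show ?thesis
    using sum_single_keys[of f] by simp
qed

text \<open>If an exponent splits in only one way over the keys, the convolution sum has at most one
  nonzero term, so nothing can cancel. This serves for products with a monomial and for the least
  exponents in \<open>cylinder_primary\<close>.\<close>

lemma lookup_mult_unique:
  fixes f g :: "'a::comm_monoid_add \<Rightarrow>\<^sub>0 'b::comm_semiring_1"
  assumes "\<And>a' b'. a' \<in> Poly_Mapping.keys f \<Longrightarrow> b' \<in> Poly_Mapping.keys g \<Longrightarrow> a' + b' = a + b \<Longrightarrow> a' = a \<and> b' = b"
  shows "Poly_Mapping.lookup (f * g) (a + b) = Poly_Mapping.lookup f a * Poly_Mapping.lookup g b"
proof -
  have "Poly_Mapping.lookup (f * g) (a + b) =
      (\<Sum>l. Poly_Mapping.lookup f l * (\<Sum>q. Poly_Mapping.lookup g q when a + b = l + q))"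
    by (simp add: lookup_mult)
  also have "\<dots> = (\<Sum>l. (Poly_Mapping.lookup f l * Poly_Mapping.lookup g b) when l = a)"
  proof (rule Sum_any.cong)
    fix l
    show "Poly_Mapping.lookup f l * (\<Sum>q. Poly_Mapping.lookup g q when a + b = l + q) =
      ((Poly_Mapping.lookup f l * Poly_Mapping.lookup g b) when l = a)"
    proof (cases "l \<in> Poly_Mapping.keys f")
      case True
      have "(\<Sum>q. Poly_Mapping.lookup g q when a + b = l + q) =
          (\<Sum>q. (Poly_Mapping.lookup g q when l = a) when q = b)"
      proof (rule Sum_any.cong)
        fix q
        show "(Poly_Mapping.lookup g q when a + b = l + q) = ((Poly_Mapping.lookup g q when l = a) when q = b)"
        proof (cases "q \<in> Poly_Mapping.keys g")
          case True
          then show ?thesis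
            using assms[OF \<open>l \<in> Poly_Mapping.keys f\<close> True] by (auto simp: when_def)
        next
          case False
          then show ?thesis by (simp add: in_keys_iff)
        qed
      qed
      then show ?thesis by (simp add: when_def)
    next
      case False
      then show ?thesis by (simp add: in_keys_iff)
    qed
  qed
  finally show ?thesis by simp
qed

lemma keys_times_monomial:
  "Poly_Mapping.keys (f * monomial w) = (\<lambda>a. a + w) ` Poly_Mapping.keys f"
proof
  show "Poly_Mapping.keys (f * monomial w) \<subseteq> (\<lambda>a. a + w) ` Poly_Mapping.keys f"
    using keys_mult[of f "monomial w"] by (auto simp: monomial_def)
  have "Poly_Mapping.lookup (f * monomial w) (a + w) = Poly_Mapping.lookup f a" for a
    using lookup_mult_unique[of f "monomial w" a w] by (auto simp: monomial_def)
  then show "(\<lambda>a. a + w) ` Poly_Mapping.keys f \<subseteq> Poly_Mapping.keys (f * monomial w)"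
    by (auto simp: in_keys_iff)
qed

section \<open>The polynomial ring as a ring of \<open>HOL-Algebra\<close>\<close>

lemma mpoly_ring_simps [simp]:
  "carrier mpoly_ring = UNIV" "x \<otimes>\<^bsub>mpoly_ring\<^esub> y = x * y" "x \<oplus>\<^bsub>mpoly_ring\<^esub> y = x + y"
  "\<one>\<^bsub>mpoly_ring\<^esub> = 1" "\<zero>\<^bsub>mpoly_ring\<^esub> = 0"
  by (simp_all add: ring_of_type_algebra_def)

lemma mpoly_ring_pow [simp]: "x [^]\<^bsub>mpoly_ring\<^esub> (k::nat) = x ^ k"
  by (induction k) (simp_all add: nat_pow_def mult.commute)

lemma cring_mpoly_ring: "cring (mpoly_ring :: ('n, 'k::field) mpolynomial ring)"
  by (rule cring_from_type_algebra)

lemma ring_mpoly_ring: "ring (mpoly_ring :: ('n, 'k::field) mpolynomial ring)"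
  by (rule ring_from_type_algebra)

lemma mpoly_idealI:
  fixes I :: "('n, 'k::field) mpolynomial set"
  assumes "0 \<in> I" "\<And>x y. x \<in> I \<Longrightarrow> y \<in> I \<Longrightarrow> x + y \<in> I" "\<And>x y. x \<in> I \<Longrightarrow> y * x \<in> I"
  shows "ideal I mpoly_ring"
proof -
  interpret R: cring "mpoly_ring :: ('n, 'k) mpolynomial ring" by (rule cring_mpoly_ring)
  have neg: "\<ominus>\<^bsub>mpoly_ring\<^esub> x = - x" for x :: "('n, 'k) mpolynomial"
    using R.minus_equality[of "- x" x] by simp
  show ?thesis
  proof (rule idealI)
    show "subgroup I (add_monoid mpoly_ring)"
      using assms(3)[of _ "-1"] assms(1,2) by (intro R.add.subgroupI) (auto simp: neg)
  qed (use assms in \<open>auto simp: ring_mpoly_ring mult.commute\<close>)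
qed

lemma mpoly_idealD:
  fixes I :: "('n, 'k::field) mpolynomial set"
  assumes "ideal I mpoly_ring"
  shows "0 \<in> I" "\<And>x y. x \<in> I \<Longrightarrow> y \<in> I \<Longrightarrow> x + y \<in> I" "\<And>x y. x \<in> I \<Longrightarrow> y * x \<in> I"
    "\<And>x y. x \<in> I \<Longrightarrow> x * y \<in> I"
proof -
  interpret ideal I mpoly_ring by fact
  show "0 \<in> I" using additive_subgroup.zero_closed[OF is_additive_subgroup] by simp
  show "x + y \<in> I" if "x \<in> I" "y \<in> I" for x y 
    using additive_subgroup.a_closed[OF is_additive_subgroup that] by simp
  show "y * x \<in> I" if "x \<in> I" for x y using I_l_closed[OF that, of y] by simp
  then show "x * y \<in> I" if "x \<in> I" for x y using that by (simp add: mult.commute)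
qed

lemma mpoly_primeidealD:
  fixes P :: "('n, 'k::field) mpolynomial set"
  assumes "primeideal P mpoly_ring"
  shows "1 \<notin> P" "x * y \<in> P \<Longrightarrow> x \<in> P \<or> y \<in> P"
proof -
  interpret primeideal P mpoly_ring by fact
  show "1 \<notin> P" using I_notcarr one_imp_carrier by auto
  show "x * y \<in> P \<Longrightarrow> x \<in> P \<or> y \<in> P" using I_prime[of x y] by simp
qed

section \<open>Ideal operations as operations on exponent sets\<close>

lemma ideal_supported:
  assumes "upset U"
  shows "ideal (supported U :: ('n, 'k::field) mpolynomial set) mpoly_ring"
proof (rule mpoly_idealI)
  fix x y :: "('n, 'k) mpolynomial"
  show "y * x \<in> supported U" if "x \<in> supported U"
    using that keys_mult[of y x] assms
    by (auto simp: supported_def upset_def add.commute subset_iff) (metis add.commute)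
  show "x + y \<in> supported U" if "x \<in> supported U" "y \<in> supported U"
    using that keys_add[of x y] by (auto simp: supported_def)
qed (simp add: supported_def)

lemma ideal_prod_supported:
  "ideal_prod mpoly_ring (supported U) (supported W) = (supported (sumset U W) :: ('n, 'k::field) mpolynomial set)"
proof
  show "ideal_prod mpoly_ring (supported U) (supported W) \<subseteq> (supported (sumset U W) :: ('n, 'k) mpolynomial set)"
  proof
    fix f :: "('n, 'k) mpolynomial"
    assume "f \<in> ideal_prod mpoly_ring (supported U) (supported W)"
    then show "f \<in> supported (sumset U W)"
    proof induction
      case (prod i j)
      then show ?case
        using keys_mult[of i j] by (fastforce simp: supported_def sumset_def)
    next
      case (sum f g)
      then show ?case
        using keys_add[of f g] by (auto simp: supported_def)
    qed
  qed
  show "supported (sumset U W) \<subseteq> ideal_prod mpoly_ring (supported U) (supported W :: ('n, 'k) mpolynomial set)"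
  proof
    fix f :: "('n, 'k) mpolynomial"
    assume f: "f \<in> supported (sumset U W)"
    show "f \<in> ideal_prod mpoly_ring (supported U) (supported W)"
    proof (rule additive_closure_memI)
      show "0 \<in> ideal_prod mpoly_ring (supported U) (supported W :: ('n, 'k) mpolynomial set)"
        using ideal_prod.prod[of 0 "supported U" 0 "supported W" "mpoly_ring :: ('n, 'k) mpolynomial ring"]
        by (simp add: supported_def)
    next
      fix x y :: "('n, 'k) mpolynomial"
      assume "x \<in> ideal_prod mpoly_ring (supported U) (supported W)"
        "y \<in> ideal_prod mpoly_ring (supported U) (supported W)"
      then show "x + y \<in> ideal_prod mpoly_ring (supported U) (supported W)"
        using ideal_prod.sum by fastforce
    next
      fix a and c :: 'k
      assume "a \<in> Poly_Mapping.keys f"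
      then obtain u w where a: "a = u + w" "u \<in> U" "w \<in> W"
        using f by (auto simp: supported_def sumset_def)
      \<comment> \<open>The term splits as a product in which the first factor carries the whole
        coefficient.\<close>
      have "Poly_Mapping.single u c \<in> supported U" "(Poly_Mapping.single w 1 :: ('n, 'k) mpolynomial) \<in> supported W"
        using a by (auto simp: supported_def)
      from ideal_prod.prod[OF this, of mpoly_ring]
      show "Poly_Mapping.single a c \<in> ideal_prod mpoly_ring (supported U) (supported W)"
        by (simp add: mult_single a(1))
    qed
  qed
qed

lemma ideal_power_supported:
  "ideal_power mpoly_ring (supported U) k = (supported (sumset_power U k) :: ('n, 'k::field) mpolynomial set)"
proof (induction k)
  case 0
  then show ?case by (simp add: nat_pow_def ideals_set_def supported_def)
next
  case (Suc k)
  then show ?case by (simp add: nat_pow_def ideals_set_def ideal_prod_supported)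
qed

text \<open>Adding \<open>UNIV\<close> closes \<open>A\<close> under multiples; the ideal contains
  each term with such an exponent by absorption.\<close>

lemma genideal_monomials:
  "Idl\<^bsub>mpoly_ring\<^esub> (monomial ` A) = (supported (sumset A UNIV) :: ('n, 'k::field) mpolynomial set)"
proof -
  interpret R: cring "mpoly_ring :: ('n, 'k) mpolynomial ring" by (rule cring_mpoly_ring)
  have up: "upset (sumset A UNIV)" by (rule upset_sumset) (simp add: upset_def)
  show ?thesis
  proof
    have "A \<subseteq> sumset A UNIV"
      by (force simp: sumset_def intro: exI[of _ 0])
    then show "Idl\<^bsub>mpoly_ring\<^esub> (monomial ` A) \<subseteq> (supported (sumset A UNIV) :: ('n, 'k) mpolynomial set)"
      by (intro R.genideal_minimal ideal_supported up) auto
    let ?J = "Idl\<^bsub>mpoly_ring\<^esub> (monomial ` A) :: ('n, 'k) mpolynomial set"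
    have "ideal ?J mpoly_ring" by (rule R.genideal_ideal) simp
    note J = mpoly_idealD[OF this]
    have gen: "monomial ` A \<subseteq> ?J" by (rule R.genideal_self) simp
    show "supported (sumset A UNIV) \<subseteq> ?J"
    proof
      fix f :: "('n, 'k) mpolynomial"
      assume f: "f \<in> supported (sumset A UNIV)"
      show "f \<in> ?J"
      proof (rule additive_closure_memI)
        fix a and c :: 'k
        assume "a \<in> Poly_Mapping.keys f"
        then obtain u w where a: "a = u + w" "u \<in> A"
          using f by (auto simp: supported_def sumset_def)
        have "monomial u * Poly_Mapping.single w c \<in> ?J"
          using gen a(2) by (intro J) auto
        then show "Poly_Mapping.single a c \<in> ?J"
          by (simp add: monomial_def mult_single a(1))
      qed (use J in auto)
    qed
  qed
qed

text \<open>A product with a monomial only translates the keys, so testing a polynomial against the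
  monomials of the second ideal already constrains each of its terms.\<close>

lemma colon_supported:
  "colon_ideal mpoly_ring (supported U) (supported W) =
   (supported {a. \<forall>w\<in>W. a + w \<in> U} :: ('n, 'k::field) mpolynomial set)"
proof (intro equalityI subsetI)
  fix f :: "('n, 'k) mpolynomial"
  assume f: "f \<in> colon_ideal mpoly_ring (supported U) (supported W)"
  have "a + w \<in> U" if "a \<in> Poly_Mapping.keys f" "w \<in> W" for a w
  proof -
    have "f * monomial w \<in> supported U"
      using f that(2) by (auto simp: colon_ideal_def)
    then show ?thesis using that(1) by (auto simp: supported_def keys_times_monomial)
  qed
  then show "f \<in> supported {a. \<forall>w\<in>W. a + w \<in> U}" by (auto simp: supported_def)
next
  fix f :: "('n, 'k) mpolynomial"
  assume f: "f \<in> supported {a. \<forall>w\<in>W. a + w \<in> U}"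
  have "f * g \<in> supported U" if "g \<in> supported W" for g
    using f that keys_mult[of f g] by (fastforce simp: supported_def)
  then show "f \<in> colon_ideal mpoly_ring (supported U) (supported W)"
    by (auto simp: colon_ideal_def)
qed

lemma monomial_ideal_iff:
  "monomial_ideal I \<longleftrightarrow> (\<exists>U. upset U \<and> I = supported U)"
proof
  assume "monomial_ideal I"
  then show "\<exists>U. upset U \<and> I = supported U"
    unfolding monomial_ideal_def genideal_monomials
    using upset_sumset[of UNIV] by (auto simp: upset_def)
next
  assume "\<exists>U. upset U \<and> I = supported U"
  then obtain U where U: "upset U" "I = supported U" by blast
  have "sumset U UNIV = U"
    using U(1) by (force simp: sumset_def upset_def intro: exI[of _ 0])
  then show "monomial_ideal I"
    unfolding monomial_ideal_def genideal_monomials using U(2) by metis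
qed

section \<open>Saturation and Borel type\<close>

lemma sumset_shift_power:
  "sumset ((\<lambda>i. shift i (e i)) ` V) UNIV = {a. \<exists>i\<in>V. e i \<le> expo a i}"
proof (intro equalityI subsetI)
  fix a assume "a \<in> {a. \<exists>i\<in>V. e i \<le> expo a i}"
  then obtain i where i: "i \<in> V" "e i \<le> expo a i" by blast
  then have "a = shift i (e i) + (a - shift i (e i))"
    by (intro le_imp_eq_add) (auto simp: lookup_single when_def)
  with i(1) show "a \<in> sumset ((\<lambda>i. shift i (e i)) ` V) UNIV"
    unfolding sumset_def by blast
qed (force simp: sumset_def lookup_add)

lemma genideal_var_powers:
  "Idl\<^bsub>mpoly_ring\<^esub> ((\<lambda>i. var_power i (e i)) ` V) =
    (supported {a. \<exists>i\<in>V. e i \<le> expo a i} :: ('n, 'k::field) mpolynomial set)"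
proof -
  have "(\<lambda>i. var_power i (e i)) ` V = (monomial ` (\<lambda>i. shift i (e i)) ` V :: ('n, 'k) mpolynomial set)"
    by (auto simp: var_power_def)
  then show ?thesis by (simp only: genideal_monomials sumset_shift_power)
qed

lemma genideal_variables:
  "Idl\<^bsub>mpoly_ring\<^esub> (variable ` V) = (supported (prime_exps V) :: ('n, 'k::field) mpolynomial set)"
  using genideal_var_powers[of "\<lambda>_. 1" V] by (simp add: prime_exps_def Suc_le_eq)

text \<open>The \<open>k\<close>-th power of a prime generated by variables is spanned by the
  monomials of degree at least \<open>k\<close> in these variables; the induction splits off one
  variable that occurs.\<close>

lemma sumset_power_prime_exps:
  fixes V :: "'n::finite set"
  shows "sumset_power (prime_exps V) k = {a. k \<le> (\<Sum>i\<in>V. expo a i)}"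
proof (induction k)
  case (Suc k)
  show ?case
  proof (intro equalityI subsetI)
    fix a assume "a \<in> sumset_power (prime_exps V) (Suc k)"
    then obtain b c i where "a = b + c" "k \<le> (\<Sum>i\<in>V. expo b i)" and i: "i \<in> V" "0 < expo c i"
      unfolding sumset_power.simps Suc by (auto simp: sumset_def prime_exps_def)
    moreover have "expo c i \<le> (\<Sum>i\<in>V. expo c i)" using i by (intro member_le_sum) auto
    ultimately show "a \<in> {a. Suc k \<le> (\<Sum>i\<in>V. expo a i)}"
      by (simp add: lookup_add sum.distrib)
  next
    fix a assume a: "a \<in> {a. Suc k \<le> (\<Sum>i\<in>V. expo a i)}"
    then have "0 < sum (expo a) V" by auto
    then obtain i where i: "i \<in> V" "0 < expo a i"
      by (metis sum.neutral neq0_conv less_irrefl)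
    have eq: "a = (a - shift i 1) + shift i 1"
      by (subst add.commute, rule le_imp_eq_add) (use i in \<open>auto simp: lookup_single when_def\<close>)
    have "(\<Sum>j\<in>V. expo a j) = (\<Sum>j\<in>V. expo (a - shift i 1) j) + (\<Sum>j\<in>V. expo (shift i 1) j)"
      unfolding sum.distrib[symmetric] lookup_add[symmetric] eq[symmetric] ..
    moreover have "(\<Sum>j\<in>V. expo (shift i 1) j) = 1"
      using i(1) by (simp add: lookup_single when_def)
    ultimately have "k \<le> (\<Sum>j\<in>V. expo (a - shift i 1) j)" using a by simp
    moreover have "shift i 1 \<in> prime_exps V" using i by (auto simp: prime_exps_def intro!: bexI[of _ i])
    ultimately show "a \<in> sumset_power (prime_exps V) (Suc k)"
      unfolding sumset_power.simps Suc sumset_def using eq by blast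
  qed
qed simp

lemma saturation_variables:
  fixes V :: "'n::finite set"
  shows "saturation mpoly_ring (supported U) (Idl\<^bsub>mpoly_ring\<^esub> (variable ` V)) =
    (supported {a. \<exists>k. \<forall>w. k \<le> (\<Sum>i\<in>V. expo w i) \<longrightarrow> a + w \<in> U} :: ('n, 'k::field) mpolynomial set)"
    (is "?L = supported {a. \<exists>k. ?P k a}")
proof -
  have "?L = (\<Union>k. supported {a. ?P k a})"
    unfolding saturation_def genideal_variables ideal_power_supported colon_supported
      sumset_power_prime_exps by auto
  also have "\<dots> = supported {a. \<exists>k. ?P k a}"
  proof (intro equalityI subsetI)
    fix f :: "('n, 'k) mpolynomial"
    assume "f \<in> supported {a. \<exists>k. ?P k a}"
    then have "\<forall>a\<in>Poly_Mapping.keys f. \<exists>k. ?P k a" by (auto simp: supported_def)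
    then obtain k where k: "\<And>a. a \<in> Poly_Mapping.keys f \<Longrightarrow> ?P (k a) a" by metis
    \<comment> \<open>The bound has to be uniform over all terms of \<open>f\<close>. The sum of the
      bounds of the finitely many keys dominates each of them.\<close>
    have "?P (\<Sum>a\<in>Poly_Mapping.keys f. k a) a" if "a \<in> Poly_Mapping.keys f" for a
      using k[OF that] member_le_sum[of a "Poly_Mapping.keys f" k] that by fastforce
    then show "f \<in> (\<Union>k. supported {a. ?P k a})" by (auto simp: supported_def)
  qed (auto simp: supported_def)
  finally show ?thesis .
qed

text \<open>Only one inclusion of saturations remains as a condition: the degree in the variables up
  to \<open>j\<close> is at least the exponent of \<open>j\<close>, which gives the other
  one.\<close>

lemma borel_type_supported_iff:
  fixes U :: "('n::{finite,linorder} \<Rightarrow>\<^sub>0 nat) set"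
  assumes "upset U"
  shows "borel_type (supported U :: ('n, 'k::field) mpolynomial set) \<longleftrightarrow>
    (\<forall>j a k. (\<forall>w. k \<le> expo w j \<longrightarrow> a + w \<in> U) \<longrightarrow>
       (\<exists>k. \<forall>w. k \<le> (\<Sum>i\<le>j. expo w i) \<longrightarrow> a + w \<in> U))"
proof -
  have le: "expo w j \<le> (\<Sum>i\<le>j. expo w i)" for w :: "'n \<Rightarrow>\<^sub>0 nat" and j
    by (rule member_le_sum) auto
  have single: "{variable j} = variable ` {j}" for j :: 'n by simp
  have "monomial_ideal (supported U :: ('n, 'k) mpolynomial set)"
    using assms by (auto simp: monomial_ideal_iff)
  then show ?thesis
    unfolding borel_type_def single saturation_variables supported_inject
    by (auto simp: set_eq_iff) (use le order_trans in blast)+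
qed

section \<open>Cylinders\<close>

text \<open>
  These are the exponent sets of the monomial ideals generated by monomials in the variables from
  \<open>V\<close> that contain a power of each of these variables.
\<close>

definition cylinder :: "'n set \<Rightarrow> ('n \<Rightarrow>\<^sub>0 nat) set \<Rightarrow> bool" where
  "cylinder V W \<longleftrightarrow> upset W \<and> (\<forall>a b. a \<in> W \<longrightarrow> (\<forall>i\<in>V. expo a i = expo b i) \<longrightarrow> b \<in> W) \<and>
     (\<forall>i\<in>V. \<exists>N. shift i N \<in> W)"

lemma cylinder_cong:
  assumes "cylinder V W" "\<And>i. i \<in> V \<Longrightarrow> expo a i = expo b i"
  shows "a \<in> W \<longleftrightarrow> b \<in> W"
  using assms unfolding cylinder_def by metis

lemma cylinder_prime_exps: "cylinder V (prime_exps V)"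
  unfolding cylinder_def
proof (intro conjI upset_prime_exps ballI)
  show "\<exists>N. shift i N \<in> prime_exps V" if "i \<in> V" for i
    using that by (intro exI[of _ 1]) (simp add: prime_exps_def bexI[of _ i])
  show "\<forall>a b. a \<in> prime_exps V \<longrightarrow> (\<forall>i\<in>V. expo a i = expo b i) \<longrightarrow> b \<in> prime_exps V"
    unfolding prime_exps_def mem_Collect_eq by metis
qed

lemma cylinder_sumset:
  fixes V :: "'n::finite set"
  assumes "cylinder V W" "cylinder V W'"
  shows "cylinder V (sumset W W')"
proof -
  have "b \<in> sumset W W'" if a: "a \<in> sumset W W'" and eq: "\<And>i. i \<in> V \<Longrightarrow> expo a i = expo b i" for a b
  proof -
    obtain w w' where w: "a = w + w'" "w \<in> W" "w' \<in> W'"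
      using a by (auto simp: sumset_def)
    \<comment> \<open>The coordinates of \<open>b\<close> outside \<open>V\<close> are all put into
      the first summand and none into the second; on \<open>V\<close> the given splitting is
      kept.\<close>
    define v where "v = Abs_poly_mapping (\<lambda>i. if i \<in> V then expo w i else expo b i)"
    define v' where "v' = Abs_poly_mapping (\<lambda>i. if i \<in> V then expo w' i else 0)"
    have "v \<in> W" using w(2) cylinder_cong[OF assms(1), of w v] by (simp add: v_def)
    moreover have "v' \<in> W'" using w(3) cylinder_cong[OF assms(2), of w' v'] by (simp add: v'_def)
    moreover have "b = v + v'"
      by (rule poly_mapping_eqI) (use eq in \<open>auto simp: v_def v'_def lookup_add w(1)\<close>)
    ultimately show ?thesis by (auto simp: sumset_def)
  qed
  moreover have "\<exists>N. shift i N \<in> sumset W W'" if "i \<in> V" for i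
  proof -
    obtain N N' where "shift i N \<in> W" "shift i N' \<in> W'"
      using assms \<open>i \<in> V\<close> by (meson cylinder_def)
    then have "shift i (N + N') \<in> sumset W W'"
      by (auto simp: sumset_def single_add)
    then show ?thesis ..
  qed
  moreover have "upset (sumset W W')"
    using assms(2) by (intro upset_sumset) (simp add: cylinder_def)
  ultimately show ?thesis unfolding cylinder_def by blast
qed

lemma cylinder_sumset_power:
  fixes V :: "'n::finite set"
  assumes "cylinder V W"
  shows "cylinder V (sumset_power W k)"
proof (induction k)
  case 0
  then show ?case by (simp add: cylinder_def upset_def)
next
  case (Suc k)
  then show ?case using assms by (simp add: cylinder_sumset)
qed

lemma cylinder_Int:
  assumes "cylinder V W" "cylinder V W'"
  shows "cylinder V (W \<inter> W')"
proof -
  have up: "upset W" "upset W'" using assms by (simp_all add: cylinder_def)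
  have "\<exists>N. shift i N \<in> W \<inter> W'" if "i \<in> V" for i
  proof -
    obtain N N' where N: "shift i N \<in> W" "shift i N' \<in> W'"
      using assms \<open>i \<in> V\<close> by (meson cylinder_def)
    have "shift i (N + N') \<in> W" "shift i (N + N') \<in> W'"
      using upsetD[OF up(1) N(1), of "shift i N'"] upsetD[OF up(2) N(2), of "shift i N"]
      by (simp_all add: single_add add.commute)
    then show ?thesis by blast
  qed
  moreover have "b \<in> W \<inter> W'" if "a \<in> W \<inter> W'" "\<forall>i\<in>V. expo a i = expo b i" for a b
    using that cylinder_cong[OF assms(1), of a b] cylinder_cong[OF assms(2), of a b] by simp
  moreover have "upset (W \<inter> W')" using up by (auto simp: upset_def)
  ultimately show ?thesis unfolding cylinder_def by blast
qed

lemma cylinder_INT: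
  assumes "finite A" "\<And>x. x \<in> A \<Longrightarrow> cylinder V (W x)"
  shows "cylinder V (\<Inter>x\<in>A. W x)"
  using assms
proof (induction A rule: finite_induct)
  case empty
  then show ?case by (simp add: cylinder_def upset_def)
qed (simp add: cylinder_Int)

text \<open>Pigeonhole: a large degree in \<open>V\<close> forces one coordinate past the power of
  its variable that lies in \<open>W\<close>. In ideal terms, some power of the prime is contained
  in the ideal.\<close>

lemma cylinder_large:
  fixes V :: "'n::finite set"
  assumes "cylinder V W"
  obtains k where "\<And>w. k \<le> (\<Sum>i\<in>V. expo w i) \<Longrightarrow> w \<in> W"
proof -
  obtain N where N: "\<And>i. i \<in> V \<Longrightarrow> shift i (N i) \<in> W"
    using assms unfolding cylinder_def by metis
  \<comment> \<open>For empty \<open>V\<close> both sums are 0 and \<open>W\<close> may be empty;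
    \<open>Suc\<close> makes the claim vacuous there.\<close>
  have "w \<in> W" if "Suc (\<Sum>i\<in>V. N i) \<le> (\<Sum>i\<in>V. expo w i)" for w
  proof -
    have "\<not> (\<forall>i\<in>V. expo w i \<le> N i)"
      using that sum_mono[of V "expo w" N] by auto
    then obtain i where i: "i \<in> V" "N i < expo w i" by (auto simp: not_le)
    have "upset W" using assms by (simp add: cylinder_def)
    then show ?thesis
      by (rule upset_le[OF _ N[OF i(1)]]) (use i(2) in \<open>auto simp: lookup_single when_def\<close>)
  qed
  then show thesis by (rule that)
qed

text \<open>
  Order exponents by their degree in \<open>V\<close>, then lexicographically. If some exponent of \<open>g\<close> avoids \<open>V\<close>,
  the least exponent of \<open>g\<close> does, so adding it to the least exponent of \<open>f\<close> outside \<open>W\<close> gives an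
  exponent outside \<open>W\<close>, whose coefficient in \<open>g * f\<close> cannot cancel.
\<close>

lemma cylinder_primary:
  fixes V :: "'n::{finite,linorder} set" and f g :: "('n, 'k::field) mpolynomial"
  assumes cyl: "cylinder V W" and gf: "g * f \<in> supported W" and f: "f \<notin> supported W"
  shows "g \<in> supported (prime_exps V)"
proof (rule ccontr)
  assume g: "g \<notin> supported (prime_exps V)"
  define deg where "deg = (\<lambda>a. \<Sum>i\<in>V. expo a i)"
  have deg_add: "deg (a + b) = deg a + deg b" for a b
    by (simp add: deg_def lookup_add sum.distrib)
  define B where "B = {b \<in> Poly_Mapping.keys g. deg b = 0}"
  have B: "finite B" "B \<noteq> {}"
    using g by (auto simp: B_def supported_def prime_exps_def deg_def)
  define b where "b = Min B"
  have b: "b \<in> B" "\<And>b'. b' \<in> B \<Longrightarrow> b \<le> b'" using B by (simp_all add: b_def)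
  define A where "A = Poly_Mapping.keys f - W"
  have A: "finite A" "A \<noteq> {}" using f by (auto simp: A_def supported_def)
  define d where "d = Min (deg ` A)"
  have d: "d \<in> deg ` A" "\<And>a'. a' \<in> A \<Longrightarrow> d \<le> deg a'"
    using A by (simp_all add: d_def)
  define A' where "A' = {a \<in> A. deg a = d}"
  have A': "finite A'" "A' \<noteq> {}" using A d by (auto simp: A'_def)
  define a where "a = Min A'"
  have a: "a \<in> A'" "\<And>a'. a' \<in> A' \<Longrightarrow> a \<le> a'" using A' by (simp_all add: a_def)
  have b0: "\<forall>i\<in>V. expo b i = 0" using b(1) by (simp add: B_def deg_def)
  have ab: "a + b \<notin> W"
    using cylinder_cong[OF cyl, of "a + b" a] a(1) b0 by (auto simp: A'_def A_def lookup_add)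
  have "a' = a \<and> b' = b"
    if a': "a' \<in> Poly_Mapping.keys f" and b': "b' \<in> Poly_Mapping.keys g" and eq: "a' + b' = a + b" for a' b'
  proof -
    have "upset W" using cyl by (simp add: cylinder_def)
    then have "a' \<notin> W" using upsetD[of W a' b'] ab eq by auto
    then have a'A: "a' \<in> A" using a' by (simp add: A_def)
    have "deg a' + deg b' = deg a + deg b" using arg_cong[OF eq, of deg] by (simp add: deg_add)
    then have "deg a' + deg b' = d" using a(1) b(1) by (simp add: A'_def B_def)
    with d(2)[OF a'A] have "deg a' = d" "deg b' = 0" by auto
    then have "a \<le> a'" "b \<le> b'" using a(2) b(2) a'A b' by (auto simp: A'_def B_def)
    then show ?thesis using eq
      by (metis add_less_le_mono add_le_less_mono less_irrefl order_le_less)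
  qed
  then have "Poly_Mapping.lookup (f * g) (a + b) = Poly_Mapping.lookup f a * Poly_Mapping.lookup g b"
    by (rule lookup_mult_unique)
  also have "\<dots> \<noteq> 0"
    using a(1) b(1) by (auto simp: A'_def A_def B_def in_keys_iff)
  finally have "a + b \<in> Poly_Mapping.keys (g * f)" by (simp add: in_keys_iff mult.commute)
  with gf ab show False by (auto simp: supported_def)
qed

text \<open>For a cylinder, \<open>sub\<close> says that \<open>W\<close> is not everything. One
  inclusion is primality, read off from \<open>cylinder_primary\<close> for the cylinder
  \<open>prime_exps V\<close>; for the other, a high power of \<open>f\<close> has only terms of
  high degree in \<open>V\<close>.\<close>

lemma radical_cylinder:
  fixes V :: "'n::{finite,linorder} set"
  assumes cyl: "cylinder V W" and sub: "W \<subseteq> prime_exps V"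
  shows "radical_ideal mpoly_ring (supported W) = (supported (prime_exps V) :: ('n, 'k::field) mpolynomial set)"
proof (intro equalityI subsetI)
  fix f :: "('n, 'k) mpolynomial"
  assume "f \<in> radical_ideal mpoly_ring (supported W)"
  then obtain k where "f ^ k \<in> supported W" by (auto simp: radical_ideal_def)
  then have "f ^ k \<in> supported (prime_exps V)" using sub by (auto simp: supported_def)
  then show "f \<in> supported (prime_exps V)"
  proof (induction k)
    case 0
    then show ?case by (auto simp: supported_def prime_exps_def)
  next
    case (Suc k)
    then show ?case using cylinder_primary[OF cylinder_prime_exps, of f "f ^ k" V] by auto
  qed
next
  fix f :: "('n, 'k) mpolynomial"
  assume f: "f \<in> supported (prime_exps V)"
  have pow: "f ^ k \<in> supported (sumset_power (prime_exps V) k)" for k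
  proof (induction k)
    case 0
    then show ?case by (simp add: supported_def)
  next
    case (Suc k)
    then show ?case
      using f keys_mult[of "f ^ k" f] unfolding power_Suc2 by (fastforce simp: supported_def sumset_def)
  qed
  obtain k where "\<And>w. k \<le> (\<Sum>i\<in>V. expo w i) \<Longrightarrow> w \<in> W"
    using cylinder_large[OF cyl] by blast
  then have "f ^ k \<in> supported W"
    using pow[of k] by (auto simp: sumset_power_prime_exps supported_def)
  then show "f \<in> radical_ideal mpoly_ring (supported W)"
    by (auto simp: radical_ideal_def)
qed

section \<open>Dickson's lemma\<close>

lemma nat_incseq_subseq:
  fixes s :: "nat \<Rightarrow> nat"
  shows "\<exists>r. strict_mono r \<and> incseq (\<lambda>k. s (r k))"
proof -
  obtain r :: "nat \<Rightarrow> nat" where r: "strict_mono r" "monoseq (\<lambda>k. s (r k))"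
    using seq_monosub by blast
  show ?thesis
  proof (cases "incseq (\<lambda>k. s (r k))")
    case False
    then have dec: "decseq (\<lambda>k. s (r k))" using r(2) by (simp add: monoseq_iff)
    \<comment> \<open>A decreasing sequence of naturals is constant from an index on at which its
      minimum is attained, so its tail is also increasing.\<close>
    obtain p where p: "\<And>k. s (r p) \<le> s (r k)"
      using ex_has_least_nat[of "\<lambda>_. True" 0 "\<lambda>k. s (r k)"] by auto
    have "s (r (p + k)) = s (r p)" for k
      using p[of "p + k"] decseqD[OF dec, of p "p + k"] by simp
    moreover have "strict_mono (\<lambda>k. r (p + k))"
      using r(1) by (simp add: strict_mono_def)
    ultimately show ?thesis by (intro exI[of _ "\<lambda>k. r (p + k)"]) (simp add: incseq_def)
  qed (use r in blast)
qed

lemma incseq_subseq_family: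
  fixes s :: "nat \<Rightarrow> 'i \<Rightarrow> nat"
  assumes "finite S"
  shows "\<exists>r. strict_mono r \<and> (\<forall>i\<in>S. incseq (\<lambda>k. s (r k) i))"
  using assms
proof (induction S rule: finite_induct)
  case empty
  show ?case by (rule exI[of _ id]) (simp add: strict_mono_def)
next
  case (insert i S)
  then obtain r where r: "strict_mono r" "\<And>i. i \<in> S \<Longrightarrow> incseq (\<lambda>k. s (r k) i)" by blast
  obtain r' where r': "strict_mono r'" "incseq (\<lambda>k. s (r (r' k)) i)"
    using nat_incseq_subseq[of "\<lambda>k. s (r k) i"] by blast
  have "incseq (\<lambda>k. s (r (r' k)) j)" if "j \<in> S" for j
    using r(2)[OF that] strict_mono_mono[OF r'(1)] by (auto simp: mono_def)
  then show ?case
    using strict_mono_o[OF r(1) r'(1)] r'(2) by (intro exI[of _ "r \<circ> r'"]) (simp add: comp_def)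
qed

text \<open>The generators are the minimal elements of \<open>U\<close>. Infinitely many of them
  would contain a componentwise increasing subsequence, against minimality; below each element of
  \<open>U\<close> a minimal one is found by minimizing the degree.\<close>

lemma dickson:
  fixes U :: "('n::finite \<Rightarrow>\<^sub>0 nat) set"
  assumes "upset U"
  shows "\<exists>A. finite A \<and> U = sumset A UNIV"
proof -
  define A where "A = {a \<in> U. \<forall>b\<in>U. (\<forall>i. expo b i \<le> expo a i) \<longrightarrow> b = a}"
  have "finite A"
  proof (rule ccontr)
    assume "infinite A"
    then obtain s :: "nat \<Rightarrow> 'n \<Rightarrow>\<^sub>0 nat" where s: "inj s" "range s \<subseteq> A"
      using infinite_countable_subset by blast
    obtain r :: "nat \<Rightarrow> nat" where r: "strict_mono r" "\<And>i. incseq (\<lambda>k. expo (s (r k)) i)"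
      using incseq_subseq_family[of "UNIV :: 'n set" "\<lambda>k. expo (s k)"] by auto
    have "expo (s (r 0)) i \<le> expo (s (r 1)) i" for i
      using incseqD[OF r(2), of 0 1] by simp
    moreover have "s (r 0) \<in> A" "s (r 1) \<in> A" using s(2) by auto
    ultimately have "s (r 0) = s (r 1)" by (auto simp: A_def)
    then have "r 0 = r 1" using s(1) by (simp add: inj_eq)
    then show False using r(1) by (simp add: strict_mono_eq)
  qed
  moreover have "U = sumset A UNIV"
  proof (intro equalityI subsetI)
    fix u assume "u \<in> U"
    define deg where "deg = (\<lambda>a :: 'n \<Rightarrow>\<^sub>0 nat. \<Sum>i\<in>UNIV. expo a i)"
    obtain b where b: "b \<in> U" "\<And>i. expo b i \<le> expo u i"
      and min: "\<And>c. c \<in> U \<Longrightarrow> (\<And>i. expo c i \<le> expo u i) \<Longrightarrow> deg b \<le> deg c"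
      using ex_has_least_nat[of "\<lambda>b. b \<in> U \<and> (\<forall>i. expo b i \<le> expo u i)" u deg] \<open>u \<in> U\<close> by auto
    have "c = b" if c: "c \<in> U" "\<forall>i. expo c i \<le> expo b i" for c
    proof (rule ccontr)
      assume "c \<noteq> b"
      then obtain i where "expo c i \<noteq> expo b i" using poly_mapping_eqI by metis
      then have "deg c < deg b" unfolding deg_def
        using c(2) by (intro sum_strict_mono_ex1) (auto simp: order_less_le)
      moreover have "deg b \<le> deg c" using c b by (intro min) (auto intro: order_trans)
      ultimately show False by simp
    qed
    then have "b \<in> A" using b(1) by (simp add: A_def)
    then show "u \<in> sumset A UNIV" using le_imp_eq_add[OF b(2)] unfolding sumset_def by blast
  next
    fix u assume "u \<in> sumset A UNIV"
    then show "u \<in> U" using assms by (auto simp: sumset_def A_def upset_def)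
  qed
  ultimately show ?thesis by blast
qed

section \<open>Irreducible decompositions\<close>

text \<open>
  The bounds \<open>e\<close> encode the irreducible ideal generated by the powers \<open>x\<^sub>i ^ e i\<close> with \<open>e i\<close>
  finite; a variable with \<open>e i = \<infinity>\<close> does not occur.
\<close>

definition outside :: "('n \<Rightarrow> enat) \<Rightarrow> ('n \<Rightarrow>\<^sub>0 nat) set" where
  "outside e = {a. \<exists>i. e i \<le> enat (expo a i)}"

lemma upset_outside: "upset (outside e)"
proof -
  have "e i \<le> enat (expo a i + expo b i)" if "e i \<le> enat (expo a i)" for a b i
    using that by (rule order_trans) simp
  then show ?thesis unfolding upset_def outside_def by (auto simp: lookup_add)
qed

lemma outside_min: "outside (\<lambda>i. min (e i) (e' i)) = outside e \<union> outside e'"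
  by (auto simp: outside_def min_le_iff_disj)

lemma outside_subset_prime_exps:
  assumes "\<And>i. 0 < e i"
  shows "outside e \<subseteq> prime_exps {i. e i \<noteq> \<infinity>}"
proof
  fix a assume "a \<in> outside e"
  then obtain i where i: "e i \<le> enat (expo a i)" by (auto simp: outside_def)
  then have "e i \<noteq> \<infinity>" by (metis enat_ord_simps(5) infinity_ileE)
  moreover have "0 < enat (expo a i)" using assms i by (rule less_le_trans)
  ultimately show "a \<in> prime_exps {i. e i \<noteq> \<infinity>}" by (auto simp: prime_exps_def zero_enat_def)
qed

lemma cylinder_outside: "cylinder {i. e i \<noteq> \<infinity>} (outside e)"
  unfolding cylinder_def
proof (intro conjI upset_outside ballI allI impI)
  fix a b assume "a \<in> outside e" and eq: "\<forall>i\<in>{i. e i \<noteq> \<infinity>}. expo a i = expo b i"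
  then obtain i where i: "e i \<le> enat (expo a i)" by (auto simp: outside_def)
  then have "e i \<noteq> \<infinity>" by (metis enat_ord_simps(5) infinity_ileE)
  with eq i show "b \<in> outside e" by (auto simp: outside_def intro!: exI[of _ i])
next
  fix i assume "i \<in> {i. e i \<noteq> \<infinity>}"
  then obtain n where "e i = enat n" by auto
  then show "\<exists>N. shift i N \<in> outside e"
    by (intro exI[of _ n]) (auto simp: outside_def intro!: exI[of _ i])
qed

lemma irreducible_monomial_ideal_iff:
  fixes C :: "('n::finite, 'k::field) mpolynomial set"
  shows "irreducible_monomial_ideal C \<longleftrightarrow> (\<exists>e. (\<forall>i. 0 < e i) \<and> C = supported (outside e))"
proof
  assume "irreducible_monomial_ideal C"
  then obtain V h where h: "\<forall>i\<in>V. 0 < h i" "C = supported {a. \<exists>i\<in>V. h i \<le> expo a i}"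
    unfolding irreducible_monomial_ideal_def genideal_var_powers by blast
  define e where "e = (\<lambda>i. if i \<in> V then enat (h i) else \<infinity>)"
  have "\<forall>i. 0 < e i" using h(1) by (auto simp: e_def zero_enat_def)
  moreover have "outside e = {a. \<exists>i\<in>V. h i \<le> expo a i}"
    by (auto simp: outside_def e_def split: if_splits)
  ultimately show "\<exists>e. (\<forall>i. 0 < e i) \<and> C = supported (outside e)"
    using h(2) by (intro exI[of _ e]) simp
next
  assume "\<exists>e. (\<forall>i. 0 < e i) \<and> C = supported (outside e)"
  then obtain e where e: "\<forall>i. 0 < e i" "C = supported (outside e)" by blast
  define h where "h = (\<lambda>i. the_enat (e i))"
  have fin: "e i = enat (h i)" if "e i \<noteq> \<infinity>" for i using that by (auto simp: h_def)
  have "0 < h i" if "e i \<noteq> \<infinity>" for i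
    using e(1)[rule_format, of i] fin[OF that] by (simp add: zero_enat_def)
  then have "\<forall>i\<in>{i. e i \<noteq> \<infinity>}. 0 < h i" by blast
  moreover have "outside e = {a. \<exists>i\<in>{i. e i \<noteq> \<infinity>}. h i \<le> expo a i}"
  proof -
    have "e i \<le> enat n \<longleftrightarrow> e i \<noteq> \<infinity> \<and> h i \<le> n" for i n
      by (cases "e i") (auto simp: h_def)
    then show ?thesis by (auto simp: outside_def simp del: not_infinity_eq)
  qed
  ultimately show "irreducible_monomial_ideal C"
    unfolding irreducible_monomial_ideal_def genideal_var_powers e(2)
    by (intro exI[of _ "{i. e i \<noteq> \<infinity>}"] exI[of _ h] conjI) simp_all
qed

text \<open>
  The exponents divisible by \<open>a\<close> are the intersection, over the variables occurring in \<open>a\<close>, of the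
  exponents divisible by \<open>x\<^sub>i ^ a i\<close>; distributing unions over intersections adds one generator.
\<close>

lemma sumset_UNIV_eq_INT_outside:
  fixes A :: "('n::finite \<Rightarrow>\<^sub>0 nat) set"
  assumes "finite A"
  shows "\<exists>E. finite E \<and> (\<forall>e\<in>E. \<forall>i. 0 < e i) \<and> sumset A UNIV = (\<Inter>e\<in>E. outside e)"
  using assms
proof (induction A rule: finite_induct)
  case empty
  \<comment> \<open>The zero ideal is itself irreducible: no variable has a finite bound.\<close>
  have "outside (\<lambda>_ :: 'n. \<infinity>) = {}" by (simp add: outside_def)
  then have "sumset ({} :: ('n \<Rightarrow>\<^sub>0 nat) set) UNIV = (\<Inter>e\<in>{\<lambda>_. \<infinity>}. outside e)" by (simp add: sumset_def)
  then show ?case by (intro exI[of _ "{\<lambda>_. \<infinity>}"]) simp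
next
  case (insert a A)
  then obtain E where E: "finite E" "\<forall>e\<in>E. \<forall>i. 0 < e i" "sumset A UNIV = (\<Inter>e\<in>E. outside e)" by blast
  define h where "h = (\<lambda>i j. if j = i then enat (expo a i) else \<infinity>)"
  have h: "outside (h i) = {b. expo a i \<le> expo b i}" for i
    by (auto simp: outside_def h_def split: if_splits)
  \<comment> \<open>Restricting to the variables that occur keeps the bounds positive. For
    \<open>a = 0\<close> no index is left, and the empty intersection is everything, as a unit
    generator demands.\<close>
  define S where "S = {i. 0 < expo a i}"
  define E' where "E' = (\<lambda>(e, i) j. min (e j) (h i j)) ` (E \<times> S)"
  have "sumset {a} UNIV = (\<Inter>i\<in>S. outside (h i))"
  proof (intro equalityI subsetI)
    fix b assume b: "b \<in> (\<Inter>i\<in>S. outside (h i))"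
    have "expo a i \<le> expo b i" for i
      using b by (cases "i \<in> S") (auto simp: h, simp add: S_def)
    from le_imp_eq_add[OF this] show "b \<in> sumset {a} UNIV" by (auto simp: sumset_def)
  qed (auto simp: sumset_def h lookup_add)
  moreover have "sumset (insert a A) UNIV = sumset {a} UNIV \<union> sumset A UNIV"
    by (auto simp: sumset_def)
  moreover have "(\<Inter>e\<in>E'. outside e) = (\<Inter>(e, i)\<in>E \<times> S. outside e \<union> outside (h i))"
    by (simp add: E'_def case_prod_beta outside_min)
  moreover have "\<dots> = (\<Inter>i\<in>S. outside (h i)) \<union> (\<Inter>e\<in>E. outside e)" by auto
  ultimately have "sumset (insert a A) UNIV = (\<Inter>e\<in>E'. outside e)" using E(3) by simp
  moreover have "finite E'" using E(1) by (simp add: E'_def)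
  moreover have "\<forall>e\<in>E'. \<forall>i. 0 < e i"
    using E(2) by (auto simp: E'_def h_def S_def min_def zero_enat_def)
  ultimately show ?case by blast
qed

section \<open>Existence and uniqueness of the irredundant decomposition\<close>

lemma irredundant_decomposition_exists:
  fixes U :: "('n::finite \<Rightarrow>\<^sub>0 nat) set"
  assumes "upset U"
  shows "\<exists>D. irredundant_decomposition (supported U :: ('n, 'k::field) mpolynomial set) D"
proof -
  let ?I = "supported U :: ('n, 'k) mpolynomial set"
  obtain A where "finite A" "U = sumset A UNIV" using dickson[OF assms] by blast
  then obtain E where E: "finite E" "\<forall>e\<in>E. \<forall>i. 0 < e i" "U = (\<Inter>e\<in>E. outside e)"
    using sumset_UNIV_eq_INT_outside[of A] by blast
  define D0 where "D0 = (\<lambda>e. supported (outside e) :: ('n, 'k) mpolynomial set) ` E"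
  have D0: "finite D0" "\<Inter>D0 = ?I"
    using E by (simp_all add: D0_def supported_Inter)
  have irr: "\<forall>C\<in>D0. irreducible_monomial_ideal C"
    unfolding D0_def irreducible_monomial_ideal_iff ball_simps
  proof
    show "\<exists>e'. (\<forall>i. 0 < e' i) \<and> supported (outside e) = (supported (outside e') :: ('n, 'k) mpolynomial set)"
      if "e \<in> E" for e
      using E(2) that by (intro exI[of _ e]) simp
  qed
  \<comment> \<open>A subfamily of least cardinality with the same intersection cannot lose a
    member.\<close>
  obtain D where D: "D \<subseteq> D0" "\<Inter>D = ?I"
    and min: "\<And>D'. D' \<subseteq> D0 \<Longrightarrow> \<Inter>D' = ?I \<Longrightarrow> card D \<le> card D'"
    using ex_has_least_nat[of "\<lambda>D. D \<subseteq> D0 \<and> \<Inter>D = ?I" D0 card] D0(2) by auto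
  have fin: "finite D" using D(1) D0(1) by (rule finite_subset)
  have "\<Inter>(D - {C}) \<noteq> ?I" if "C \<in> D" for C
    using min[of "D - {C}"] D(1) card_Diff1_less[OF fin that] by auto
  then show ?thesis
    using fin D irr by (intro exI[of _ D]) (auto simp: irredundant_decomposition_def)
qed

text \<open>The complement of \<open>outside e\<close> is closed under least common multiples. If
  every member of \<open>D\<close> had a monomial avoiding \<open>C\<close>, their least common
  multiple would lie in all members and still avoid \<open>C\<close>.\<close>

lemma irreducible_contains_component:
  fixes C :: "('n::finite, 'k::field) mpolynomial set"
  assumes "finite D" "\<forall>C\<in>D. irreducible_monomial_ideal C" "irreducible_monomial_ideal C" "\<Inter>D \<subseteq> C"
  shows "\<exists>C'\<in>D. C' \<subseteq> C"
proof (rule ccontr)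
  assume contra: "\<not> (\<exists>C'\<in>D. C' \<subseteq> C)"
  obtain e where e: "\<forall>i. 0 < e i" "C = supported (outside e)"
    using assms(3) by (auto simp: irreducible_monomial_ideal_iff)
  have upC: "\<exists>W. C' = supported W \<and> upset W" if "C' \<in> D" for C'
    using assms(2) that upset_outside unfolding irreducible_monomial_ideal_iff by blast
  have "\<exists>u. monomial u \<in> C' \<and> u \<notin> outside e" if "C' \<in> D" for C'
  proof -
    obtain W where W: "C' = supported W" using upC[OF \<open>C' \<in> D\<close>] by blast
    moreover have "\<not> C' \<subseteq> C" using contra that by blast
    ultimately obtain u where "u \<in> W" "u \<notin> outside e"
      using e(2) by (auto simp: supported_def)
    then show ?thesis using W by auto
  qed
  then obtain u where u: "\<And>C'. C' \<in> D \<Longrightarrow> monomial (u C') \<in> C'" "\<And>C'. C' \<in> D \<Longrightarrow> u C' \<notin> outside e"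
    by metis
  \<comment> \<open>The least common multiple of the chosen monomials. The inserted 0 covers empty
    \<open>D\<close>; a coordinate that reaches the positive bound \<open>e i\<close> is nonzero,
    hence attained by some \<open>u C'\<close>.\<close>
  define m where "m = Abs_poly_mapping (\<lambda>i. Max (insert 0 ((\<lambda>C'. expo (u C') i) ` D)))"
  have m: "expo m i = Max (insert 0 ((\<lambda>C'. expo (u C') i) ` D))" for i by (simp add: m_def)
  have "monomial m \<in> C'" if "C' \<in> D" for C'
  proof -
    obtain W where W: "C' = supported W" "upset W" using upC[OF \<open>C' \<in> D\<close>] by blast
    have "monomial (u C') \<in> (supported W :: ('n, 'k) mpolynomial set)" using u(1)[OF that] W(1) by blast
    then have "u C' \<in> W" by simp
    then have "m \<in> W"
    proof (rule upset_le[OF W(2)])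
      show "expo (u C') i \<le> expo m i" for i
        unfolding m using assms(1) that by (intro Max_ge) auto
    qed
    then show ?thesis by (simp add: W(1))
  qed
  then have "monomial m \<in> \<Inter>D" by blast
  then have "m \<in> outside e" using assms(4) e(2) by auto
  then obtain i where i: "e i \<le> enat (expo m i)" by (auto simp: outside_def)
  have "expo m i \<in> insert 0 ((\<lambda>C'. expo (u C') i) ` D)"
    unfolding m using assms(1) by (intro Max_in) auto
  moreover have "expo m i \<noteq> 0" using i e(1)[rule_format, of i] by (cases "expo m i = 0") (auto simp: zero_enat_def[symmetric])
  ultimately obtain C' where "C' \<in> D" "expo m i = expo (u C') i" by auto
  moreover from this(1) have "u C' \<notin> outside e" using u(2) by blast
  ultimately show False using i by (auto simp: outside_def)
qed

lemma irredundant_decomposition_antichain: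
  assumes "irredundant_decomposition I D" "C \<in> D" "C' \<in> D" "C' \<subseteq> C"
  shows "C' = C"
proof (rule ccontr)
  assume "C' \<noteq> C"
  then have "\<Inter>(D - {C}) = \<Inter>D" using assms(2-4) by fast
  then show False using assms(1,2) by (auto simp: irredundant_decomposition_def)
qed

text \<open>Passing from \<open>D\<close> to \<open>D'\<close> and back gives a chain of components
  that starts and ends in \<open>D\<close>, so it collapses by the antichain property. By symmetry
  this yields the uniqueness behind \<open>THE\<close>.\<close>

lemma irredundant_decomposition_subset:
  fixes I :: "('n::finite, 'k::field) mpolynomial set"
  assumes "irredundant_decomposition I D" "irredundant_decomposition I D'"
  shows "D \<subseteq> D'"
proof
  fix C assume C: "C \<in> D"
  have D: "finite D" "\<forall>C\<in>D. irreducible_monomial_ideal C" "\<Inter>D = I"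
    and D': "finite D'" "\<forall>C\<in>D'. irreducible_monomial_ideal C" "\<Inter>D' = I"
    using assms by (simp_all add: irredundant_decomposition_def)
  have "\<Inter>D' \<subseteq> C" using C D(3) D'(3) by blast
  then obtain C' where C': "C' \<in> D'" "C' \<subseteq> C"
    using irreducible_contains_component[OF D'(1,2)] D(2) C by blast
  have "\<Inter>D \<subseteq> C'" using C' D(3) D'(3) by blast
  then obtain C'' where "C'' \<in> D" "C'' \<subseteq> C'"
    using irreducible_contains_component[OF D(1,2)] D'(2) C' by blast
  then have "C' = C"
    using irredundant_decomposition_antichain[OF assms(1) C, of C''] C'(2) by blast
  then show "C \<in> D'" using C' by simp
qed

lemma irreducible_components:
  fixes U :: "('n::finite \<Rightarrow>\<^sub>0 nat) set"
  assumes "upset U"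
  shows "irredundant_decomposition (supported U :: ('n, 'k::field) mpolynomial set)
    (irreducible_components (supported U))"
  unfolding irreducible_components_def
  by (rule theI') (metis irredundant_decomposition_exists[OF assms] irredundant_decomposition_subset subset_antisym)

text \<open>
  Irredundancy gives a monomial outside one component \<open>C\<close> but inside all others; raising its
  exponents to the largest values that avoid \<open>C\<close> makes its annihilator the radical of \<open>C\<close>.
\<close>

lemma component_witness:
  fixes U :: "('n::finite \<Rightarrow>\<^sub>0 nat) set"
  assumes D: "irredundant_decomposition (supported U :: ('n, 'k::field) mpolynomial set) D"
    and C: "C \<in> D" "C = supported (outside e)" and e: "\<And>i. 0 < e i"
  shows "\<exists>c. \<forall>w. c + w \<in> U \<longleftrightarrow> w \<in> prime_exps {i. e i \<noteq> \<infinity>}"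
proof -
  have ID: "\<Inter>D = (supported U :: ('n, 'k) mpolynomial set)"
    and irr: "\<forall>C\<in>D. irreducible_monomial_ideal C" and "\<Inter>(D - {C}) \<noteq> supported U"
    using D C(1) by (simp_all add: irredundant_decomposition_def)
  moreover have "\<Inter>D = C \<inter> \<Inter>(D - {C})" using C(1) by blast
  ultimately obtain f where f: "f \<in> \<Inter>(D - {C})" "f \<notin> C" by blast
  obtain u where u: "u \<in> Poly_Mapping.keys f" "u \<notin> outside e"
    using f(2) C(2) by (auto simp: supported_def)
  \<comment> \<open>A positive finite bound \<open>n\<close> admits the values up to
    \<open>n - 1\<close>. An infinite bound leaves no largest value, so the exponent of
    \<open>u\<close> is kept.\<close>
  define c where "c = Abs_poly_mapping (\<lambda>i. case e i of enat n \<Rightarrow> n - 1 | \<infinity> \<Rightarrow> expo u i)"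
  have c: "expo c i = (case e i of enat n \<Rightarrow> n - 1 | \<infinity> \<Rightarrow> expo u i)" for i by (simp add: c_def)
  have uc: "expo u i \<le> expo c i" for i
  proof -
    have "enat (expo u i) < e i" using u(2) by (simp add: outside_def not_le)
    then show ?thesis by (cases "e i") (auto simp: c)
  qed
  have rest: "(monomial (c + w) :: ('n, 'k) mpolynomial) \<in> \<Inter>(D - {C})" for w
  proof
    fix C' assume C': "C' \<in> D - {C}"
    then obtain e' where e': "C' = supported (outside e')"
      using irr unfolding irreducible_monomial_ideal_iff by blast
    have "f \<in> C'" using f(1) C' by blast
    then have "u \<in> outside e'" using u(1) by (auto simp: supported_def e')
    from upset_le[OF upset_outside this, of "c + w"] have "c + w \<in> outside e'"
      using uc by (auto simp: lookup_add intro: trans_le_add1)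
    then show "monomial (c + w) \<in> C'" by (simp add: e')
  qed
  have "c + w \<in> U \<longleftrightarrow> w \<in> prime_exps {i. e i \<noteq> \<infinity>}" for w
  proof -
    have "c + w \<in> U \<longleftrightarrow> (monomial (c + w) :: ('n, 'k) mpolynomial) \<in> \<Inter>D"
      by (simp only: ID monomial_in_supported)
    also have "\<dots> \<longleftrightarrow> (monomial (c + w) :: ('n, 'k) mpolynomial) \<in> C"
      using rest[of w] C(1) by blast
    also have "\<dots> \<longleftrightarrow> (\<exists>i. e i \<le> enat (expo c i + expo w i))"
      by (simp add: C(2) outside_def lookup_add)
    also have "\<dots> \<longleftrightarrow> (\<exists>i. e i \<noteq> \<infinity> \<and> 0 < expo w i)"
    proof (rule arg_cong[of _ _ Ex], rule ext)
      fix i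
      show "e i \<le> enat (expo c i + expo w i) \<longleftrightarrow> e i \<noteq> \<infinity> \<and> 0 < expo w i"
        using e[of i] by (cases "e i") (auto simp: c zero_enat_def)
    qed
    finally show ?thesis by (simp add: prime_exps_def)
  qed
  then show ?thesis by blast
qed

section \<open>Quasi-symbolic powers and their associated primes\<close>

text \<open>Collects what the theorem needs to know about the canonical presentation. Primary
  components are indexed by sets \<open>V\<close> of variables instead of radicals; each
  \<open>V\<close> comes with a monomial whose annihilator modulo the ideal is the corresponding
  prime.\<close>

lemma quasi_symbolic_power_supported:
  fixes U :: "('n::{finite,linorder} \<Rightarrow>\<^sub>0 nat) set"
  assumes "upset U"
  obtains \<V> W where "finite \<V>"
    and "quasi_symbolic_power (supported U :: ('n, 'k::field) mpolynomial set) q = supported (\<Inter>V\<in>\<V>. W V)"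
    and "\<And>V. V \<in> \<V> \<Longrightarrow> cylinder V (W V)"
    and "\<And>V. V \<in> \<V> \<Longrightarrow> \<exists>c. \<forall>w. c + w \<in> U \<longleftrightarrow> w \<in> prime_exps V"
proof -
  let ?I = "supported U :: ('n, 'k) mpolynomial set"
  define D where "D = irreducible_components ?I"
  have irred: "irredundant_decomposition ?I D"
    unfolding D_def by (rule irreducible_components[OF assms])
  then have finD: "finite D" by (simp add: irredundant_decomposition_def)
  have "\<exists>e. (\<forall>i. 0 < e i) \<and> C = supported (outside e)" if "C \<in> D" for C
    using irred that by (auto simp: irredundant_decomposition_def irreducible_monomial_ideal_iff)
  then obtain e where e: "\<And>C i. C \<in> D \<Longrightarrow> 0 < e C i" "\<And>C. C \<in> D \<Longrightarrow> C = supported (outside (e C))"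
    by metis
  define vars where "vars = (\<lambda>C. {i. e C i \<noteq> \<infinity>})"
  have rad: "radical_ideal mpoly_ring C = supported (prime_exps (vars C))" if "C \<in> D" for C
    using radical_cylinder[OF cylinder_outside outside_subset_prime_exps, of "e C", where 'k = 'k]
      e(1)[OF that] e(2)[OF that, symmetric]
    unfolding vars_def by (simp del: not_infinity_eq)
  define Q where "Q = (\<lambda>V. \<Inter>C\<in>{C \<in> D. vars C = V}. outside (e C))"
  have comp: "primary_component ?I (supported (prime_exps V)) = supported (Q V)" for V
  proof -
    have "{C \<in> D. radical_ideal mpoly_ring C = supported (prime_exps V)} = {C \<in> D. vars C = V}"
      using rad by (auto simp: supported_inject prime_exps_inj)
    moreover have "\<Inter>{C \<in> D. vars C = V} = supported (Q V)"
      unfolding Q_def supported_Inter using e(2) by auto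
    ultimately show ?thesis by (simp add: primary_component_def D_def)
  qed
  have "canonical_presentation ?I = (\<lambda>V. supported (Q V)) ` vars ` D"
    unfolding canonical_presentation_def D_def[symmetric] image_image
    by (rule image_cong) (simp_all add: rad comp)
  then have "quasi_symbolic_power ?I q = supported (\<Inter>V\<in>vars ` D. sumset_power (Q V) q)"
    by (simp add: quasi_symbolic_power_def supported_Inter ideal_power_supported)
  moreover have "cylinder V (sumset_power (Q V) q)" for V
    unfolding Q_def using finD cylinder_outside
    by (intro cylinder_sumset_power cylinder_INT) (auto simp: vars_def)
  moreover have "\<exists>c. \<forall>w. c + w \<in> U \<longleftrightarrow> w \<in> prime_exps V" if "V \<in> vars ` D" for V
    using that component_witness[OF irred] e unfolding vars_def by blast
  ultimately show thesis using finD by (intro that[of "vars ` D" "\<lambda>V. sumset_power (Q V) q"]) auto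
qed

section \<open>Annihilators and prime ideals\<close>

lemma ass_quotient_mpoly:
  fixes I :: "('n, 'k::field) mpolynomial set"
  assumes "ideal I mpoly_ring"
  shows "ass_quotient mpoly_ring I = {P. primeideal P mpoly_ring \<and> (\<exists>f. P = {g. g * f \<in> I})}"
proof -
  interpret ideal I mpoly_ring by fact
  have "(I +>\<^bsub>mpoly_ring\<^esub> g) \<otimes>\<^bsub>mpoly_ring Quot I\<^esub> (I +>\<^bsub>mpoly_ring\<^esub> f) = \<zero>\<^bsub>mpoly_ring Quot I\<^esub> \<longleftrightarrow> g * f \<in> I" for f g
  proof -
    have "(I +>\<^bsub>mpoly_ring\<^esub> g) \<otimes>\<^bsub>mpoly_ring Quot I\<^esub> (I +>\<^bsub>mpoly_ring\<^esub> f) = I +>\<^bsub>mpoly_ring\<^esub> (g * f)"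
      using rcoset_mult_add[of g f] by (simp add: FactRing_def)
    moreover have "I +>\<^bsub>mpoly_ring\<^esub> (g * f) = I \<longleftrightarrow> g * f \<in> I"
      using rcos_const_imp_mem[of "g * f"] a_rcos_zero[OF ideal_axioms, of "g * f"] by auto
    ultimately show ?thesis by (simp add: FactRing_def)
  qed
  moreover have "carrier (mpoly_ring Quot I) = range (\<lambda>f. I +>\<^bsub>mpoly_ring\<^esub> f)"
    by (auto simp: FactRing_def A_RCOSETS_def')
  ultimately show ?thesis by (simp add: ass_quotient_def)
qed

lemma primeideal_prod_mem:
  fixes P :: "('n, 'k::field) mpolynomial set"
  assumes "primeideal P mpoly_ring" "finite A" "(\<Prod>x\<in>A. h x) \<in> P"
  shows "\<exists>x\<in>A. h x \<in> P"
  using assms(2,3)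
proof (induction A rule: finite_induct)
  case empty
  then show ?case using mpoly_primeidealD(1)[OF assms(1)] by simp
next
  case (insert x A)
  then show ?case using mpoly_primeidealD(2)[OF assms(1), of "h x"] by auto
qed

lemma primeideal_power_mem:
  fixes P :: "('n, 'k::field) mpolynomial set"
  assumes "primeideal P mpoly_ring" "f ^ k \<in> P"
  shows "f \<in> P"
  using primeideal_prod_mem[OF assms(1), of "{..<k}" "\<lambda>_. f"] assms(2) by auto

lemma monomial_shift_power: "(monomial (shift i k) :: ('n, 'k::field) mpolynomial) = variable i ^ k"
proof (induction k)
  case 0
  then show ?case by (simp add: monomial_def)
next
  case (Suc k)
  have "(monomial (shift i (Suc k)) :: ('n, 'k) mpolynomial) = monomial (shift i 1) * monomial (shift i k)"
    by (simp add: monomial_def mult_single single_add[symmetric])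
  then show ?case by (simp add: Suc var_power_def)
qed

text \<open>\<open>P\<close> is the intersection of the annihilators of \<open>f\<close> modulo the
  components. Being prime, it contains one of them: otherwise elements \<open>h V\<close> outside
  \<open>P\<close> would have a product in \<open>P\<close>. For that component primariness bounds
  \<open>P\<close> from above, and the powers of variables lying in it bound \<open>P\<close> from
  below.\<close>

lemma ass_cylinders:
  fixes W :: "'n::{finite,linorder} set \<Rightarrow> ('n \<Rightarrow>\<^sub>0 nat) set"
  assumes fin: "finite \<V>" and cyl: "\<And>V. V \<in> \<V> \<Longrightarrow> cylinder V (W V)"
    and P: "primeideal P mpoly_ring" "P = {g :: ('n, 'k::field) mpolynomial. g * f \<in> supported (\<Inter>V\<in>\<V>. W V)}"
  shows "\<exists>V\<in>\<V>. P = supported (prime_exps V)"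
proof -
  have up: "upset (W V)" if "V \<in> \<V>" for V using cyl[OF that] by (simp add: cylinder_def)
  have ideal: "ideal (supported (W V) :: ('n, 'k) mpolynomial set) mpoly_ring" if "V \<in> \<V>" for V
    using up[OF that] by (rule ideal_supported)
  have P': "g \<in> P \<longleftrightarrow> (\<forall>V\<in>\<V>. g * f \<in> supported (W V))" for g
    by (simp add: P(2) supported_Inter)
  have "\<exists>V\<in>\<V>. \<forall>g. g * f \<in> supported (W V) \<longrightarrow> g \<in> P"
  proof (rule ccontr)
    assume "\<not> ?thesis"
    then obtain h where h: "\<And>V. V \<in> \<V> \<Longrightarrow> h V * f \<in> supported (W V)" "\<And>V. V \<in> \<V> \<Longrightarrow> h V \<notin> P"
      by metis
    have "(\<Prod>V\<in>\<V>. h V) * f \<in> supported (W V)" if "V \<in> \<V>" for V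
    proof -
      have "(\<Prod>V\<in>\<V>. h V) * f = (\<Prod>V\<in>\<V> - {V}. h V) * (h V * f)"
        unfolding prod.remove[OF fin that, of h] by (simp only: mult_ac)
      then show ?thesis using mpoly_idealD(3)[OF ideal[OF that] h(1)[OF that]] by (simp only:)
    qed
    then have "(\<Prod>V\<in>\<V>. h V) \<in> P" by (simp add: P')
    then show False using primeideal_prod_mem[OF P(1) fin] h(2) by blast
  qed
  then obtain V where V: "V \<in> \<V>" "\<And>g. g * f \<in> supported (W V) \<Longrightarrow> g \<in> P" by blast
  have f: "f \<notin> supported (W V)"
    using V(2)[of 1] mpoly_primeidealD(1)[OF P(1)] by auto
  have "P \<subseteq> supported (prime_exps V)"
    using cylinder_primary[OF cyl[OF V(1)] _ f] P' V(1) by blast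
  moreover have "supported (prime_exps V) \<subseteq> P"
  proof -
    have "variable i \<in> P" if "i \<in> V" for i
    proof -
      obtain N where "shift i N \<in> W V" using cyl[OF V(1)] \<open>i \<in> V\<close> unfolding cylinder_def by blast
      then have "monomial (shift i N) * f \<in> supported (W V)"
        by (intro mpoly_idealD(4)[OF ideal[OF V(1)]]) simp
      then have "variable i ^ N \<in> P" using V(2) by (simp add: monomial_shift_power)
      then show ?thesis by (rule primeideal_power_mem[OF P(1)])
    qed
    then show ?thesis
      unfolding genideal_variables[symmetric]
      by (intro ring.genideal_minimal[OF ring_mpoly_ring] primeideal.axioms(1)[OF P(1)]) auto
  qed
  ultimately show ?thesis using V(1) by blast
qed

lemma annihilator_monomial:
  "{g :: ('n, 'k::field) mpolynomial. g * monomial c \<in> supported U} = supported {w. c + w \<in> U}"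
  by (auto simp: supported_def keys_times_monomial add.commute)

theorem lemma2p2:
  fixes I :: "('n::{finite,linorder}, 'k::field) mpolynomial set" and q :: nat
  assumes "infinite (UNIV :: 'k set)"
    and "CARD('n) \<ge> 2"
    and "borel_type I"
    and "q > 0"
  shows "ass_quotient mpoly_ring (quasi_symbolic_power I q) \<subseteq> ass_quotient mpoly_ring I
    \<and> borel_type (quasi_symbolic_power I q)"
proof -
  obtain U where U: "upset U" "I = supported U"
    using assms(3) by (auto simp: borel_type_def monomial_ideal_iff)
  obtain \<V> W where fin: "finite \<V>"
    and J: "quasi_symbolic_power I q = supported (\<Inter>V\<in>\<V>. W V)"
    and cyl: "\<And>V. V \<in> \<V> \<Longrightarrow> cylinder V (W V)"
    and wit: "\<And>V. V \<in> \<V> \<Longrightarrow> \<exists>c. \<forall>w. c + w \<in> U \<longleftrightarrow> w \<in> prime_exps V"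
    unfolding U(2) by (rule quasi_symbolic_power_supported[OF U(1)]) blast
  have up: "upset (\<Inter>V\<in>\<V>. W V)"
    using cyl by (auto simp: cylinder_def upset_def)
  have "ass_quotient mpoly_ring (quasi_symbolic_power I q) \<subseteq> ass_quotient mpoly_ring I"
  proof
    fix P assume "P \<in> ass_quotient mpoly_ring (quasi_symbolic_power I q)"
    then obtain f where P: "primeideal P mpoly_ring" "P = {g. g * f \<in> supported (\<Inter>V\<in>\<V>. W V)}"
      unfolding J ass_quotient_mpoly[OF ideal_supported[OF up]] by blast
    then obtain V where V: "V \<in> \<V>" "P = supported (prime_exps V)"
      using ass_cylinders[OF fin cyl P] by blast
    obtain c where "\<forall>w. c + w \<in> U \<longleftrightarrow> w \<in> prime_exps V" using wit[OF V(1)] by blast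
    then have "P = {g. g * monomial c \<in> supported U}" by (simp add: annihilator_monomial V(2))
    then show "P \<in> ass_quotient mpoly_ring I"
      unfolding U(2) ass_quotient_mpoly[OF ideal_supported[OF U(1)]] using P(1) by blast
  qed
  moreover have "borel_type (quasi_symbolic_power I q)"
    unfolding J borel_type_supported_iff[OF up]
  proof (intro allI impI)
    fix j a k assume sat: "\<forall>w. k \<le> expo w j \<longrightarrow> a + w \<in> (\<Inter>V\<in>\<V>. W V)"
    \<comment> \<open>Each component may have its own bound, since there are only finitely many of
      them.\<close>
    have "\<exists>k. \<forall>w. k \<le> (\<Sum>i\<le>j. expo w i) \<longrightarrow> a + w \<in> W V" if V: "V \<in> \<V>" for V
    proof (cases "j \<in> V")
      case True
      obtain c where c: "\<And>w. c + w \<in> U \<longleftrightarrow> w \<in> prime_exps V" using wit[OF V] by blast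
      have "\<forall>w. 1 \<le> expo w j \<longrightarrow> c + w \<in> U"
        using True by (auto simp: c prime_exps_def intro!: bexI[of _ j])
      \<comment> \<open>The witness times \<open>x_j\<close> lies in \<open>I\<close>, so Borel type
        puts its products with high powers of every earlier variable into \<open>I\<close> as well;
        this forces these variables into \<open>V\<close>.\<close>
      then obtain l where l: "\<And>w. l \<le> (\<Sum>i\<le>j. expo w i) \<Longrightarrow> c + w \<in> U"
        using assms(3) unfolding U(2) borel_type_supported_iff[OF U(1)] by blast
      have "i \<in> V" if "i \<le> j" for i
      proof -
        have "l \<le> (\<Sum>i'\<le>j. expo (shift i l) i')" using that by (simp add: lookup_single when_def)
        then have "shift i l \<in> prime_exps V" using l c by blast
        then show ?thesis by (auto simp: prime_exps_def lookup_single when_def split: if_splits)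
      qed
      \<comment> \<open>Now \<open>V\<close> contains all variables up to \<open>j\<close>, so a
        large degree in these is a large degree in \<open>V\<close>, which suffices for membership
        whatever \<open>a\<close> is.\<close>
      then have "(\<Sum>i\<le>j. expo w i) \<le> (\<Sum>i\<in>V. expo w i)" for w :: "'n \<Rightarrow>\<^sub>0 nat"
        by (intro sum_mono2) auto
      moreover obtain N where "\<And>w. N \<le> (\<Sum>i\<in>V. expo w i) \<Longrightarrow> w \<in> W V"
        using cylinder_large[OF cyl[OF V]] by blast
      moreover have "upset (W V)" using cyl[OF V] by (simp add: cylinder_def)
      ultimately show ?thesis
        by (metis add.commute order_trans upsetD)
    next
      case False
      \<comment> \<open>Multiplying by a power of \<open>x_j\<close> changes no coordinate in
        \<open>V\<close>, so \<open>a\<close> itself is already in the component.\<close>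
      have "a + shift j k \<in> W V" using sat V by simp
      moreover have "expo (a + shift j k) i = expo a i" if "i \<in> V" for i
        using that False by (auto simp: lookup_add lookup_single when_def)
      ultimately have "a \<in> W V" using cylinder_cong[OF cyl[OF V]] by blast
      then show ?thesis using cyl[OF V] by (auto simp: cylinder_def upset_def)
    qed
    then obtain K where K: "\<And>V w. V \<in> \<V> \<Longrightarrow> K V \<le> (\<Sum>i\<le>j. expo w i) \<Longrightarrow> a + w \<in> W V"
      by metis
    have "a + w \<in> W V" if "(\<Sum>V\<in>\<V>. K V) \<le> (\<Sum>i\<le>j. expo w i)" "V \<in> \<V>" for w V
      using K[OF that(2)] member_le_sum[OF that(2), of K] fin that(1) by simp
    then show "\<exists>k. \<forall>w. k \<le> (\<Sum>i\<le>j. expo w i) \<longrightarrow> a + w \<in> (\<Inter>V\<in>\<V>. W V)" by blast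
  qed
  ultimately show ?thesis ..
qed

end
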